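(* $\mathrm{HE}\supset\mathrm{IP}$: for all formulas $Px$ and $A$, the formula $(\exists x\,A\to\exists x\,Px)\to\exists x\,(\exists x\,A\to Px)$ is derivable in minimal first-order logic extended by all instances of the scheme HE.
   Context: Minimal logic is first-order natural deduction with the introduction and elimination rules for $\to,\wedge,\vee,\forall,\exists$, in which $\bot$ is a propositional constant with no special rule. Schemata, for arbitrary formulas $Px$, $Q$ (possibly with further free variables), with $Py$ denoting $Px$ with the fresh variable $y$ substituted for $x$: $\mathrm{HE}(Px) := \exists y\,(\exists x\, Px \to Py)$ (schematic form of Hilbert's Epsilon) and $\mathrm{IP}(Px,Q):=(\exists x\,Q\to\exists x\,Px)\to\exists x\,(\exists x\,Q\to Px)$ (Independence of Premise). Extending by a scheme means adding, for every formula instance of it, a premise-free deduction rule concluding that instance. $S\supset T$ means that every instance of $T$ is derivable in minimal logic extended by $S$. *)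

theory Defs
  imports Main
begin

(* First-order syntax with named variables. The signature is arbitrary: 'f and 'p are
   types of function and predicate symbols, and the number of arguments of a symbol is
   read off the length of its argument list. *)

datatype 'f tm = Var nat | Fn 'f "'f tm list"

datatype ('f, 'p) form =
    Bot
  | Pred 'p "'f tm list"
  | Imp "('f, 'p) form" "('f, 'p) form" (infixr "\<^bold>\<rightarrow>" 55)
  | Conj "('f, 'p) form" "('f, 'p) form" (infixr "\<^bold>\<and>" 65)
  | Disj "('f, 'p) form" "('f, 'p) form" (infixr "\<^bold>\<or>" 60)
  | All nat "('f, 'p) form"
  | Exi nat "('f, 'p) form"

primrec tm_vars :: "'f tm \<Rightarrow> nat set" where
  "tm_vars (Var z) = {z}"
| "tm_vars (Fn f ts) = \<Union> (set (map tm_vars ts))"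

primrec free_vars :: "('f, 'p) form \<Rightarrow> nat set" where
  "free_vars Bot = {}"
| "free_vars (Pred p ts) = \<Union> (set (map tm_vars ts))"
| "free_vars (A \<^bold>\<rightarrow> B) = free_vars A \<union> free_vars B"
| "free_vars (A \<^bold>\<and> B) = free_vars A \<union> free_vars B"
| "free_vars (A \<^bold>\<or> B) = free_vars A \<union> free_vars B"
| "free_vars (All z A) = free_vars A - {z}"
| "free_vars (Exi z A) = free_vars A - {z}"

(* All variables occurring in a formula: free, bound, or directly after a quantifier. *)
primrec vars :: "('f, 'p) form \<Rightarrow> nat set" where
  "vars Bot = {}"
| "vars (Pred p ts) = \<Union> (set (map tm_vars ts))"
| "vars (A \<^bold>\<rightarrow> B) = vars A \<union> vars B"
| "vars (A \<^bold>\<and> B) = vars A \<union> vars B"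
| "vars (A \<^bold>\<or> B) = vars A \<union> vars B"
| "vars (All z A) = insert z (vars A)"
| "vars (Exi z A) = insert z (vars A)"

primrec tm_subst :: "'f tm \<Rightarrow> 'f tm \<Rightarrow> nat \<Rightarrow> 'f tm" ("_\<langle>_'/'/_\<rangle>" [1000, 0, 0] 1000) where
  "(Var z)\<langle>t//x\<rangle> = (if z = x then t else Var z)"
| "(Fn f ts)\<langle>t//x\<rangle> = Fn f (map (\<lambda>s. s\<langle>t//x\<rangle>) ts)"

(* A\<langle>t/x\<rangle> replaces the free occurrences of x and does not rename bound variables.
   It is the intended substitution only if t is free for x in A, so every use of it
   below is guarded by free_for or by freshness. *)
primrec subst :: "('f, 'p) form \<Rightarrow> 'f tm \<Rightarrow> nat \<Rightarrow> ('f, 'p) form" ("_\<langle>_'/_\<rangle>" [1000, 0, 0] 1000) where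
  "Bot\<langle>t/x\<rangle> = Bot"
| "(Pred p ts)\<langle>t/x\<rangle> = Pred p (map (\<lambda>s. s\<langle>t//x\<rangle>) ts)"
| "(A \<^bold>\<rightarrow> B)\<langle>t/x\<rangle> = A\<langle>t/x\<rangle> \<^bold>\<rightarrow> B\<langle>t/x\<rangle>"
| "(A \<^bold>\<and> B)\<langle>t/x\<rangle> = A\<langle>t/x\<rangle> \<^bold>\<and> B\<langle>t/x\<rangle>"
| "(A \<^bold>\<or> B)\<langle>t/x\<rangle> = A\<langle>t/x\<rangle> \<^bold>\<or> B\<langle>t/x\<rangle>"
| "(All z A)\<langle>t/x\<rangle> = (if z = x then All z A else All z (A\<langle>t/x\<rangle>))"
| "(Exi z A)\<langle>t/x\<rangle> = (if z = x then Exi z A else Exi z (A\<langle>t/x\<rangle>))"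

primrec free_for :: "'f tm \<Rightarrow> nat \<Rightarrow> ('f, 'p) form \<Rightarrow> bool" where
  "free_for t x Bot \<longleftrightarrow> True"
| "free_for t x (Pred p ts) \<longleftrightarrow> True"
| "free_for t x (A \<^bold>\<rightarrow> B) \<longleftrightarrow> free_for t x A \<and> free_for t x B"
| "free_for t x (A \<^bold>\<and> B) \<longleftrightarrow> free_for t x A \<and> free_for t x B"
| "free_for t x (A \<^bold>\<or> B) \<longleftrightarrow> free_for t x A \<and> free_for t x B"
| "free_for t x (All z A) \<longleftrightarrow>
     x \<notin> free_vars (All z A) \<or> (z \<notin> tm_vars t \<and> free_for t x A)"
| "free_for t x (Exi z A) \<longleftrightarrow>
     x \<notin> free_vars (Exi z A) \<or> (z \<notin> tm_vars t \<and> free_for t x A)"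

(* S; \<Gamma> \<turnstile> A: A is derivable from the open assumptions \<Gamma> in minimal natural deduction
   extended by the members of S as premise-free rules. Unlike open assumptions, members
   of S do not restrict the eigenvariables y of AllI and ExiE. There is no rule for Bot. *)
inductive derivable ::
  "('f, 'p) form set \<Rightarrow> ('f, 'p) form set \<Rightarrow> ('f, 'p) form \<Rightarrow> bool" ("_; _ \<turnstile> _" [51, 51, 51] 50)
  for S where
  Ax: "A \<in> S \<Longrightarrow> S; \<Gamma> \<turnstile> A"
| Assm: "A \<in> \<Gamma> \<Longrightarrow> S; \<Gamma> \<turnstile> A"
| ImpI: "S; insert A \<Gamma> \<turnstile> B \<Longrightarrow> S; \<Gamma> \<turnstile> A \<^bold>\<rightarrow> B"
| ImpE: "S; \<Gamma> \<turnstile> A \<^bold>\<rightarrow> B \<Longrightarrow> S; \<Gamma> \<turnstile> A \<Longrightarrow> S; \<Gamma> \<turnstile> B"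
| ConjI: "S; \<Gamma> \<turnstile> A \<Longrightarrow> S; \<Gamma> \<turnstile> B \<Longrightarrow> S; \<Gamma> \<turnstile> A \<^bold>\<and> B"
| ConjE1: "S; \<Gamma> \<turnstile> A \<^bold>\<and> B \<Longrightarrow> S; \<Gamma> \<turnstile> A"
| ConjE2: "S; \<Gamma> \<turnstile> A \<^bold>\<and> B \<Longrightarrow> S; \<Gamma> \<turnstile> B"
| DisjI1: "S; \<Gamma> \<turnstile> A \<Longrightarrow> S; \<Gamma> \<turnstile> A \<^bold>\<or> B"
| DisjI2: "S; \<Gamma> \<turnstile> B \<Longrightarrow> S; \<Gamma> \<turnstile> A \<^bold>\<or> B"
| DisjE: "S; \<Gamma> \<turnstile> A \<^bold>\<or> B \<Longrightarrow> S; insert A \<Gamma> \<turnstile> C \<Longrightarrow> S; insert B \<Gamma> \<turnstile> C \<Longrightarrow> S; \<Gamma> \<turnstile> C"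
| AllI: "S; \<Gamma> \<turnstile> A\<langle>Var y/x\<rangle> \<Longrightarrow> free_for (Var y) x A \<Longrightarrow>
    y \<notin> free_vars (All x A) \<Longrightarrow> \<forall>B\<in>\<Gamma>. y \<notin> free_vars B \<Longrightarrow> S; \<Gamma> \<turnstile> All x A"
| AllE: "S; \<Gamma> \<turnstile> All x A \<Longrightarrow> free_for t x A \<Longrightarrow> S; \<Gamma> \<turnstile> A\<langle>t/x\<rangle>"
| ExiI: "S; \<Gamma> \<turnstile> A\<langle>t/x\<rangle> \<Longrightarrow> free_for t x A \<Longrightarrow> S; \<Gamma> \<turnstile> Exi x A"
| ExiE: "S; \<Gamma> \<turnstile> Exi x A \<Longrightarrow> S; insert (A\<langle>Var y/x\<rangle>) \<Gamma> \<turnstile> C \<Longrightarrow> free_for (Var y) x A \<Longrightarrow>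
    y \<notin> free_vars (Exi x A) \<Longrightarrow> y \<notin> free_vars C \<Longrightarrow> \<forall>B\<in>\<Gamma>. y \<notin> free_vars B \<Longrightarrow> S; \<Gamma> \<turnstile> C"

(* A scheme is the set of its formula instances. *)

definition HE :: "('f, 'p) form set" where
  "HE = {Exi y (Exi x P \<^bold>\<rightarrow> P\<langle>Var y/x\<rangle>) | x y P. y \<noteq> x \<and> y \<notin> vars P}"

(* Q may contain x: its occurrences are bound by the quantifier of Exi x Q. *)
definition IP :: "('f, 'p) form set" where
  "IP = {(Exi x Q \<^bold>\<rightarrow> Exi x P) \<^bold>\<rightarrow> Exi x (Exi x Q \<^bold>\<rightarrow> P) | x P Q. True}"

definition scheme_implies :: "('f, 'p) form set \<Rightarrow> ('f, 'p) form set \<Rightarrow> bool"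
  (infix "\<^bold>\<supset>" 50) where
  "S \<^bold>\<supset> T \<longleftrightarrow> (\<forall>A\<in>T. S; {} \<turnstile> A)"

end

theory Submission
  imports Defs
begin

text \<open>
  Let \<open>y\<close> be fresh for \<open>P\<close> and \<open>Q\<close>. The instance of \<open>HE\<close> for \<open>P\<close> provides a \<open>y\<close> such
  that \<open>P\<close> holds of \<open>y\<close> as soon as it holds of anything. This \<open>y\<close> is chosen before
  anything is known about \<open>Q\<close>, so it also witnesses independence of premise: from
  \<open>Exi x Q\<close> the hypothesis \<open>Exi x Q \<^bold>\<rightarrow> Exi x P\<close> yields \<open>Exi x P\<close>, hence \<open>P\<close> of \<open>y\<close>.

  The only work beyond this is with variables. The existential elimination uses the bound
  variable \<open>y\<close> of the \<open>HE\<close> instance as its own eigenvariable, so substituting \<open>y\<close> for \<open>y\<close>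
  must be harmless (\<open>subst_Var_same\<close>, \<open>free_for_Var_same\<close>), and the existential
  introduction instantiates \<open>x\<close> by \<open>y\<close> without capture because \<open>y\<close> does not occur in \<open>P\<close>
  (\<open>free_for_Var_fresh\<close>).
\<close>

lemma finite_tm_vars: "finite (tm_vars t)"
  by (induction t) auto

lemma finite_vars: "finite (vars A)"
  by (induction A) (auto simp: finite_tm_vars)

lemma free_vars_subset_vars: "free_vars A \<subseteq> vars A"
  by (induction A) auto

lemma tm_subst_Var_same: "s\<langle>Var x//x\<rangle> = s"
  by (induction s) (auto intro: map_idI)

lemma subst_Var_same: "A\<langle>Var x/x\<rangle> = A"
  by (induction A) (auto simp: tm_subst_Var_same)

text \<open>Only a quantifier over \<open>x\<close> could capture the substituted \<open>x\<close>, and there \<open>x\<close> does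
  not occur free.\<close>

lemma free_for_Var_same: "free_for (Var x) x A"
  by (induction A) auto

lemma free_for_Var_fresh: "y \<notin> vars A \<Longrightarrow> free_for (Var y) x A"
  by (induction A) auto

text \<open>All instances of \<open>IP\<close> with the same \<open>P\<close> reduce to instances of \<open>HE\<close> for that \<open>P\<close>;
  \<open>Q\<close> only restricts the choice of the eigenvariable \<open>y\<close>.\<close>

lemma IP_instance_derivable:
  assumes he: "Exi y (Exi x P \<^bold>\<rightarrow> P\<langle>Var y/x\<rangle>) \<in> S"
    and "y \<notin> vars P" "y \<notin> vars Q"
  shows "S; {} \<turnstile> (Exi x Q \<^bold>\<rightarrow> Exi x P) \<^bold>\<rightarrow> Exi x (Exi x Q \<^bold>\<rightarrow> P)"
proof (rule ImpI)
  let ?H = "Exi x Q \<^bold>\<rightarrow> Exi x P"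
  let ?E = "Exi x P \<^bold>\<rightarrow> P\<langle>Var y/x\<rangle>"
  have fresh: "y \<notin> free_vars P" "y \<notin> free_vars Q"
    using assms free_vars_subset_vars by blast+
  have "S; {Exi x Q, ?E, ?H} \<turnstile> Exi x P"
    by (rule ImpE[of _ _ "Exi x Q"]) (auto intro: Assm)
  then have "S; {Exi x Q, ?E, ?H} \<turnstile> P\<langle>Var y/x\<rangle>"
    by (rule ImpE[rotated]) (auto intro: Assm)
  then have "S; {?E, ?H} \<turnstile> (Exi x Q \<^bold>\<rightarrow> P)\<langle>Var y/x\<rangle>"
    by (auto intro: ImpI)
  then have "S; {?E, ?H} \<turnstile> Exi x (Exi x Q \<^bold>\<rightarrow> P)"
    by (rule ExiI) (simp add: free_for_Var_fresh assms)
  \<comment> \<open>The form that existential elimination expects when \<open>y\<close> is its own eigenvariable.\<close>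
  then have "S; insert (?E\<langle>Var y/y\<rangle>) {?H} \<turnstile> Exi x (Exi x Q \<^bold>\<rightarrow> P)"
    by (simp only: subst_Var_same)
  then show "S; {?H} \<turnstile> Exi x (Exi x Q \<^bold>\<rightarrow> P)"
    by (rule ExiE[OF Ax[OF he]]) (use fresh in \<open>simp_all only: free_for_Var_same, auto\<close>)
qed

theorem proposition12:
  shows "(HE :: ('f, 'p) form set) \<^bold>\<supset> IP"
  unfolding scheme_implies_def
proof
  fix A :: "('f, 'p) form"
  assume "A \<in> IP"
  then obtain x P Q where A: "A = (Exi x Q \<^bold>\<rightarrow> Exi x P) \<^bold>\<rightarrow> Exi x (Exi x Q \<^bold>\<rightarrow> P)"
    unfolding IP_def by blast
  have "finite (insert x (vars P \<union> vars Q))"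
    by (simp add: finite_vars)
  then obtain y where y: "y \<notin> insert x (vars P \<union> vars Q)"
    using ex_new_if_finite[OF infinite_UNIV_nat] by blast
  then have "Exi y (Exi x P \<^bold>\<rightarrow> P\<langle>Var y/x\<rangle>) \<in> HE"
    unfolding HE_def by blast
  then show "HE; {} \<turnstile> A"
    unfolding A by (rule IP_instance_derivable) (use y in auto)
qed

end
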